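(* For every integer $n \ge 1$, the intersection lattice $\mathcal{L}(\mathcal{H}_{2n-1})$ of the homogenized Linial arrangement $\mathcal{H}_{2n-1}$ and the bond lattice $\Pi_{\Gamma_{2n}}$ of the graph $\Gamma_{2n}$ are isomorphic as posets: $\mathcal{L}(\mathcal{H}_{2n-1}) \cong \Pi_{\Gamma_{2n}}$.
   Context: For $n\ge 1$, the homogenized Linial arrangement $\mathcal{H}_{2n-1}$ is the set of hyperplanes $\{x_i - x_j = y_i\}$, $1 \le i < j \le n+1$, in $\mathbb{R}^{2n+1}$ with coordinates $(x_1,\dots,x_{n+1},y_1,\dots,y_n)$. Its intersection lattice $\mathcal{L}(\mathcal{H}_{2n-1})$ is the set of all intersections of subsets of these hyperplanes (the empty intersection being the whole space), ordered by reverse inclusion. $\Gamma_{2n}$ is the bipartite graph on vertex set $[2n]=\{1,\dots,2n\}$ with edges $\{2i-1,2j\}$ for $1\le i\le j\le n$ (i.e. $u<v$ are adjacent iff $u$ is odd and $v$ is even). For a finite graph $G$ with vertex set $V$, the bond lattice $\Pi_G$ is the set of partitions $\pi$ of $V$ such that the induced subgraph of $G$ on each block of $\pi$ is connected, ordered by: $\pi\le\pi'$ iff every block of $\pi$ is contained in a block of $\pi'$. *)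

theory Defs
  imports
    "HOL-Library.FuncSet"
    "HOL-Library.Disjoint_Sets"
    "HOL-Algebra.Order"
    "Graph_Theory.Digraph_Component"
begin

section \<open>Isomorphism of posets\<close>

text \<open>\<open>order_emb\<close> alone asks only for weak partial orders, where \<open>eq\<close> may be coarser than
  equality; \<open>partial_order\<close> excludes this, so that a bijection of carriers is the right notion.\<close>

definition poset_iso :: "('a, 'c) gorder_scheme \<Rightarrow> ('b, 'd) gorder_scheme \<Rightarrow> bool" where
  "poset_iso A B \<longleftrightarrow> partial_order A \<and> partial_order B \<and>
    (\<exists>f. order_emb A B f \<and> bij_betw f (carrier A) (carrier B))"


section \<open>Intersection lattice of a hyperplane arrangement\<close>

text \<open>The ambient space \<open>V\<close> is a parameter so that the empty intersection is \<open>V\<close>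
  rather than the universe of the underlying type.\<close>

definition intersection_lattice :: "'a set \<Rightarrow> 'a set set \<Rightarrow> 'a set gorder" where
  "intersection_lattice V \<A> =
    \<lparr> carrier = {V \<inter> \<Inter>\<S> | \<S>. \<S> \<subseteq> \<A>}, eq = (=), le = (\<lambda>X Y. Y \<subseteq> X) \<rparr>"


section \<open>Homogenized Linial arrangement\<close>

text \<open>A point of $\mathbb{R}^{2n+1}$ is a pair $(x, y)$ of coordinate families
  $x_1, \dots, x_{n+1}$ and $y_1, \dots, y_n$. The families are extensional functions (fixed
  to \<open>undefined\<close> outside the index set), so each point has exactly one representation.\<close>

definition linial_space :: "nat \<Rightarrow> ((nat \<Rightarrow> real) \<times> (nat \<Rightarrow> real)) set" where
  "linial_space n = ({1..n+1} \<rightarrow>\<^sub>E UNIV) \<times> ({1..n} \<rightarrow>\<^sub>E UNIV)"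

definition linial_hyperplane :: "nat \<Rightarrow> nat \<Rightarrow> nat \<Rightarrow> ((nat \<Rightarrow> real) \<times> (nat \<Rightarrow> real)) set" where
  "linial_hyperplane n i j = {(x, y) \<in> linial_space n. x i - x j = y i}"

text \<open>The argument \<open>n\<close> gives the arrangement written $\mathcal{H}_{2n-1}$.\<close>

definition homogenized_linial :: "nat \<Rightarrow> ((nat \<Rightarrow> real) \<times> (nat \<Rightarrow> real)) set set" where
  "homogenized_linial n = {linial_hyperplane n i j | i j. 1 \<le> i \<and> i < j \<and> j \<le> n + 1}"


section \<open>Bond lattice of a graph\<close>

text \<open>An undirected graph is represented as a symmetric digraph.
  \<open>G \<restriction> B\<close> is the subgraph induced on \<open>B\<close>.\<close>

definition bond_lattice :: "('a, 'b) pre_digraph \<Rightarrow> 'a set set gorder" where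
  "bond_lattice G =
    \<lparr> carrier = {\<pi>. partition_on (verts G) \<pi> \<and> (\<forall>B\<in>\<pi>. connected (G \<restriction> B))},
      eq = (=), le = refines (verts G) \<rparr>"

text \<open>The argument \<open>n\<close> gives the graph written $\Gamma_{2n}$; each edge
  $\{2i-1, 2j\}$ contributes both of its orientations.\<close>

definition Gamma_graph :: "nat \<Rightarrow> nat pair_pre_digraph" where
  "Gamma_graph n =
    \<lparr> pverts = {1..2*n},
      parcs = {(u, v). \<exists>i j. 1 \<le> i \<and> i \<le> j \<and> j \<le> n \<and> {u, v} = {2*i - 1, 2*j}} \<rparr>"

lemma pair_graph_Gamma_graph: "pair_graph (Gamma_graph n)"
proof -
  have sub: "parcs (Gamma_graph n) \<subseteq> {1..2*n} \<times> {1..2*n}"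
    by (auto simp: Gamma_graph_def doubleton_eq_iff)
  have verts: "pverts (Gamma_graph n) = {1..2*n}"
    by (simp add: Gamma_graph_def)
  from sub have fin: "finite (parcs (Gamma_graph n))"
    by (rule finite_subset) simp
  have sym: "symmetric (with_proj (Gamma_graph n))"
    unfolding symmetric_def by (auto simp: Gamma_graph_def insert_commute intro!: symI)
  have loop: "fst e \<noteq> snd e" if "e \<in> parcs (Gamma_graph n)" for e
  proof -
    have "2 * i - 1 \<noteq> 2 * j" if "1 \<le> i" for i j :: nat
      using that by presburger
    then show ?thesis
      using that by (auto simp: Gamma_graph_def doubleton_eq_iff)
  qed
  show ?thesis
    using sub fin sym loop by unfold_locales (auto simp: verts)
qed

lemma Gamma_graph_adj_iff:
  assumes "u \<in> {1..2*n}" "v \<in> {1..2*n}" "u < v"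
  shows "(u, v) \<in> parcs (Gamma_graph n) \<longleftrightarrow> odd u \<and> even v"
proof
  assume "(u, v) \<in> parcs (Gamma_graph n)"
  then obtain i j where "1 \<le> i" "i \<le> j" "{u, v} = {2*i - 1, 2*j}"
    by (auto simp: Gamma_graph_def)
  then show "odd u \<and> even v"
    using assms by (auto simp: doubleton_eq_iff)
next
  assume uv: "odd u \<and> even v"
  then obtain a b where "u = 2 * a + 1" "v = 2 * b"
    by (metis oddE evenE)
  then have "1 \<le> a + 1 \<and> a + 1 \<le> b \<and> b \<le> n \<and> {u, v} = {2 * (a + 1) - 1, 2 * b}"
    using assms by auto
  then show "(u, v) \<in> parcs (Gamma_graph n)"
    unfolding Gamma_graph_def by (simp only: pair_pre_digraph.select_convs mem_Collect_eq prod.case) blast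
qed

end

theory Submission
  imports Defs
begin

text \<open>In the coordinates \<open>x 1\<close>, \<open>p (2i - 1) = x i - y i\<close> and \<open>p (2j) = x (j + 1)\<close> the hyperplane
  \<open>x i - x (j + 1) = y i\<close> reads \<open>p (2i - 1) = p (2j)\<close>, so the homogenized Linial arrangement is,
  up to a linear change of coordinates and a one-dimensional factor, the graphic arrangement of
  \<open>\<Gamma>\<close>. For a graphic arrangement, send a flat \<open>X\<close> to the partition of the vertices into classes
  on which every point of \<open>X\<close> is constant. If \<open>X\<close> is cut out by an edge set \<open>E\<close>, then testing
  against indicator functions of components shows that these classes are the connected
  components of \<open>E\<close>.\<close>

section \<open>Partitions and induced subgraphs\<close>

text \<open>Lets inclusion of equivalence relations stand in for refinement of partitions: a class
  of \<open>r\<close> containing \<open>a\<close> can only fit into the class of \<open>a\<close>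
  under \<open>s\<close>.\<close>

lemma refines_quotient_iff:
  assumes r: "equiv A r" and s: "equiv A s"
  shows "refines A (A // r) (A // s) \<longleftrightarrow> r \<subseteq> s"
proof
  assume R: "refines A (A // r) (A // s)"
  show "r \<subseteq> s"
  proof (rule subrelI)
    fix a b assume ab: "(a, b) \<in> r"
    then have a: "a \<in> A"
      using equiv_type[OF r] by blast
    then obtain Y where "Y \<in> A // s" "r `` {a} \<subseteq> Y"
      using R quotientI[of a A r] unfolding refines_def by blast
    moreover have "a \<in> r `` {a}" "b \<in> r `` {a}"
      using ab equiv_class_self[OF r a] by auto
    ultimately show "(a, b) \<in> s"
      using in_quotient_imp_in_rel[OF s] by blast
  qed
next
  assume "r \<subseteq> s"
  then have "\<forall>X\<in>A // r. \<exists>Y\<in>A // s. X \<subseteq> Y"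
    unfolding quotient_def by blast
  then show "refines A (A // r) (A // s)"
    by (simp add: refines_def partition_on_quotient[OF r] partition_on_quotient[OF s])
qed

lemma parcs_mk_symmetric_induce:
  "parcs (mk_symmetric (G \<restriction> B)) = (arcs_ends G \<inter> B \<times> B)\<^sup>s"
  by (auto simp: parcs_mk_symmetric arcs_ends_conv symcl_def)

text \<open>\<open>reachable\<close> is closure relative to the vertex set \<open>B\<close>. The
  induced arcs stay inside \<open>B \<times> B\<close>, so between points of \<open>B\<close> it
  agrees with the ordinary closure, which suits induction.\<close>

lemma connected_induce_iff:
  "connected (G \<restriction> B) \<longleftrightarrow> B \<noteq> {} \<and> (\<forall>u\<in>B. \<forall>v\<in>B. (u, v) \<in> ((arcs_ends G \<inter> B \<times> B)\<^sup>s)\<^sup>*)"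
proof -
  let ?R = "(arcs_ends G \<inter> B \<times> B)\<^sup>s"
  have sub: "?R \<subseteq> B \<times> B"
    by (auto simp: symcl_def)
  have "(u, v) \<in> rtrancl_on B ?R \<longleftrightarrow> (u, v) \<in> ?R\<^sup>*" if "u \<in> B" "v \<in> B" for u v
  proof
    assume "(u, v) \<in> ?R\<^sup>*"
    then show "(u, v) \<in> rtrancl_on B ?R"
      using that sub by (intro rtrancl_consistent_rtrancl_on) auto
  qed (rule rtrancl_on_rtranclI)
  then show ?thesis
    by (simp add: connected_def strongly_connected_def reachable_def parcs_mk_symmetric_induce)
qed

section \<open>Graphic arrangements\<close>

text \<open>\<open>p z\<close> reads the point \<open>z\<close> as a labelling of the vertices.
  Keeping \<open>p\<close> abstract lets different points share a labelling, as happens along the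
  extra one-dimensional factor.\<close>

definition flat :: "'z set \<Rightarrow> ('z \<Rightarrow> 'a \<Rightarrow> 'c) \<Rightarrow> ('a \<times> 'a) set \<Rightarrow> 'z set" where
  "flat V p E = {z \<in> V. \<forall>(u, v)\<in>E. p z u = p z v}"

text \<open>Together with \<open>flat\<close> this forms a Galois connection between relations on
  \<open>A\<close> and subsets of \<open>V\<close>.\<close>

definition constancy :: "'a set \<Rightarrow> ('z \<Rightarrow> 'a \<Rightarrow> 'c) \<Rightarrow> 'z set \<Rightarrow> ('a \<times> 'a) set" where
  "constancy A p X = {(u, v) \<in> A \<times> A. \<forall>z\<in>X. p z u = p z v}"

lemma equiv_constancy: "equiv A (constancy A p X)"
  by (rule equivI) (auto simp: constancy_def refl_on_def sym_def trans_def)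

lemma constancy_anti_mono: "Y \<subseteq> X \<Longrightarrow> constancy A p X \<subseteq> constancy A p Y"
  by (auto simp: constancy_def)

text \<open>The closure identity of the Galois connection: a flat can be recovered from its
  relation, which later yields order reflection and injectivity.\<close>

lemma flat_constancy:
  assumes "E \<subseteq> A \<times> A"
  shows "flat V p (constancy A p (flat V p E)) = flat V p E"
  using assms by (fastforce simp: flat_def constancy_def)

lemma carrier_intersection_lattice_flats:
  "carrier (intersection_lattice V {{z \<in> V. p z u = p z v} | u v. (u, v) \<in> R}) =
    flat V p ` Pow R"
  (is "carrier (intersection_lattice V ?H) = _")
proof -
  have in_flats: "V \<inter> \<Inter>\<S> \<in> flat V p ` Pow R" if "\<S> \<subseteq> ?H" for \<S>
  proof -
    \<comment> \<open>Distinct pairs can define the same hyperplane, for instance the two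
      orientations of an edge, so \<open>?E\<close> collects every pair whose hyperplane belongs to
      \<open>\<S>\<close>.\<close>
    let ?E = "{(u, v) \<in> R. {z \<in> V. p z u = p z v} \<in> \<S>}"
    have "V \<inter> \<Inter>\<S> = flat V p ?E"
    proof (rule Set.set_eqI)
      fix z
      have "(\<forall>H\<in>\<S>. z \<in> H) \<longleftrightarrow> (\<forall>(u, v)\<in>?E. p z u = p z v)" if "z \<in> V"
        using \<open>\<S> \<subseteq> ?H\<close> that by fastforce
      then show "z \<in> V \<inter> \<Inter>\<S> \<longleftrightarrow> z \<in> flat V p ?E"
        by (auto simp: flat_def)
    qed
    then show ?thesis
      by blast
  qed
  have flat_in: "\<exists>\<S>\<subseteq>?H. flat V p E = V \<inter> \<Inter>\<S>" if "E \<subseteq> R" for E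
    using that
    by (intro exI[of _ "(\<lambda>(u, v). {z \<in> V. p z u = p z v}) ` E"]) (auto simp: flat_def)
  have "{V \<inter> \<Inter>\<S> | \<S>. \<S> \<subseteq> ?H} = flat V p ` Pow R"
  proof (intro equalityI subsetI)
    fix X assume "X \<in> flat V p ` Pow R"
    then obtain E where "E \<subseteq> R" "X = flat V p E"
      by (elim imageE) (simp only: Pow_iff)
    moreover obtain \<S> where "\<S> \<subseteq> ?H" "flat V p E = V \<inter> \<Inter>\<S>"
      using flat_in[OF \<open>E \<subseteq> R\<close>] by (elim exE conjE)
    ultimately have "\<S> \<subseteq> ?H" "X = V \<inter> \<Inter>\<S>"
      by (simp_all only:)
    then show "X \<in> {V \<inter> \<Inter>\<S> | \<S>. \<S> \<subseteq> ?H}"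
      by (intro CollectI exI conjI)
  qed (elim CollectE exE conjE, erule ssubst, erule in_flats)
  then show ?thesis
    by (simp add: intersection_lattice_def)
qed

text \<open>Equal labels propagate along chains of edges, and surjectivity of \<open>p\<close>
  supplies labellings that separate components. Intersecting with \<open>A \<times> A\<close>
  removes the diagonal pairs outside \<open>A\<close> that the reflexive closure adds.\<close>

lemma constancy_flat:
  fixes p :: "'z \<Rightarrow> 'a \<Rightarrow> 'c::zero_neq_one"
  assumes E: "E \<subseteq> A \<times> A"
    and surj: "\<And>g :: 'a \<Rightarrow> 'c. \<exists>z\<in>V. \<forall>u\<in>A. p z u = g u"
  shows "constancy A p (flat V p E) = (E\<^sup>s)\<^sup>* \<inter> A \<times> A"
proof (intro equalityI subrelI)
  fix u v assume uv: "(u, v) \<in> constancy A p (flat V p E)"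
  then have A: "u \<in> A" "v \<in> A"
    by (auto simp: constancy_def)
  \<comment> \<open>The indicator of the component of \<open>u\<close> agrees at both ends of every
    edge of \<open>E\<close>, so \<open>z\<close> lies in the flat; its value 1 at \<open>u\<close>
    then forces \<open>v\<close> into the same component.\<close>
  obtain z where z: "z \<in> V" "\<And>w. w \<in> A \<Longrightarrow> p z w = of_bool ((u, w) \<in> (E\<^sup>s)\<^sup>*)"
    using surj[of "\<lambda>w. of_bool ((u, w) \<in> (E\<^sup>s)\<^sup>*)"] by blast
  have "(u, a) \<in> (E\<^sup>s)\<^sup>* \<longleftrightarrow> (u, b) \<in> (E\<^sup>s)\<^sup>*" if "(a, b) \<in> E" for a b
    using that by (auto simp: symcl_def intro: rtrancl_into_rtrancl)
  then have "z \<in> flat V p E"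
    using z E by (auto simp: flat_def)
  then have "p z u = p z v"
    using uv by (auto simp: constancy_def)
  then show "(u, v) \<in> (E\<^sup>s)\<^sup>* \<inter> A \<times> A"
    using z(2) A by (auto split: if_splits simp: of_bool_def)
next
  fix u v assume uv: "(u, v) \<in> (E\<^sup>s)\<^sup>* \<inter> A \<times> A"
  have "p z u = p z v" if z: "z \<in> flat V p E" for z
  proof -
    have "(u, v) \<in> (E\<^sup>s)\<^sup>*"
      using uv by blast
    then show ?thesis
    proof induction
      case (step v w)
      then show ?case
        using z by (auto simp: flat_def symcl_def)
    qed simp
  qed
  then show "(u, v) \<in> constancy A p (flat V p E)"
    using uv by (auto simp: constancy_def)
qed

lemma partial_order_intersection_lattice: "partial_order (intersection_lattice V \<A>)"
  by unfold_locales (auto simp: intersection_lattice_def)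

lemma partial_order_bond_lattice: "partial_order (bond_lattice G)"
proof unfold_locales
  fix P Q assume "P \<sqsubseteq>\<^bsub>bond_lattice G\<^esub> Q" "Q \<sqsubseteq>\<^bsub>bond_lattice G\<^esub> P"
  then show "P .=\<^bsub>bond_lattice G\<^esub> Q"
    using refines_asym by (simp add: bond_lattice_def)
qed (auto simp: bond_lattice_def intro: refines_refl refines_trans)

theorem poset_iso_graphic_arrangement:
  fixes p :: "'z \<Rightarrow> 'a \<Rightarrow> 'c::zero_neq_one"
  assumes wf: "wf_digraph G"
    and surj: "\<And>g :: 'a \<Rightarrow> 'c. \<exists>z\<in>V. \<forall>u\<in>verts G. p z u = g u"
  shows "poset_iso
    (intersection_lattice V {{z \<in> V. p z u = p z v} | u v. (u, v) \<in> arcs_ends G})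
    (bond_lattice G)"
proof -
  define A where "A = verts G"
  define D where "D = arcs_ends G"
  define L where "L = intersection_lattice V {{z \<in> V. p z u = p z v} | u v. (u, v) \<in> D}"
  define f where "f X = A // constancy A p X" for X
  have D: "D \<subseteq> A \<times> A"
    unfolding A_def D_def using wf by (auto simp: arcs_ends_conv wf_digraph_def)
  have cL: "carrier L = flat V p ` Pow D"
    unfolding L_def by (rule carrier_intersection_lattice_flats)
  have con: "constancy A p (flat V p E) = (E\<^sup>s)\<^sup>* \<inter> A \<times> A" if "E \<subseteq> D" for E
    using that D surj by (intro constancy_flat) (auto simp: A_def)
  \<comment> \<open>Larger flats have smaller constancy relations; the converse holds because
    \<open>flat\<close> reverses inclusions and recovers each flat from its relation.\<close>
  have le_iff: "refines A (f X) (f Y) \<longleftrightarrow> Y \<subseteq> X" if XY: "X \<in> carrier L" "Y \<in> carrier L" for X Y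
  proof -
    have "flat V p (constancy A p Z) = Z" if "Z \<in> carrier L" for Z
      using that D unfolding cL by (auto intro!: flat_constancy)
    moreover have "flat V p (constancy A p Y) \<subseteq> flat V p (constancy A p X)"
      if "constancy A p X \<subseteq> constancy A p Y"
      using that by (auto simp: flat_def)
    ultimately have "constancy A p X \<subseteq> constancy A p Y \<longleftrightarrow> Y \<subseteq> X"
      using XY constancy_anti_mono by metis
    then show ?thesis
      unfolding f_def by (simp add: refines_quotient_iff[OF equiv_constancy equiv_constancy])
  qed
  have f_bond: "f X \<in> carrier (bond_lattice G)" if "X \<in> carrier L" for X
  proof -
    obtain E where E: "E \<subseteq> D" "X = flat V p E"
      using \<open>X \<in> carrier L\<close> unfolding cL by blast
    let ?r = "constancy A p X"
    have r: "equiv A ?r"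
      by (rule equiv_constancy)
    have "connected (G \<restriction> B)" if B: "B \<in> A // ?r" for B
    proof -
      have "(u, v) \<in> ((D \<inter> B \<times> B)\<^sup>s)\<^sup>*" if uv: "u \<in> B" "v \<in> B" for u v
      proof -
        have "(u, v) \<in> (E\<^sup>s)\<^sup>*"
          using in_quotient_imp_in_rel[OF r B, of u v] uv con[OF E(1)] E(2) by auto
        \<comment> \<open>A walk along \<open>E\<close> starting in \<open>B\<close> never leaves
          \<open>B\<close>, since the ends of an edge of \<open>E\<close> share a class. Hence it is
          a walk in the induced subgraph.\<close>
        then have "v \<in> B \<and> (u, v) \<in> ((D \<inter> B \<times> B)\<^sup>s)\<^sup>*"
        proof induction
          case (step v w)
          have "(v, w) \<in> ?r"
            using step.hyps(2) E D con[OF E(1)] by (auto simp: symcl_def)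
          then have "w \<in> B"
            using in_quotient_imp_closed[OF r B] step.IH by blast
          moreover have "(v, w) \<in> (D \<inter> B \<times> B)\<^sup>s"
            using step.hyps(2) step.IH \<open>w \<in> B\<close> E(1) by (auto simp: symcl_def)
          ultimately show ?case
            using step.IH by (auto intro: rtrancl_into_rtrancl)
        qed (use uv in simp)
        then show ?thesis ..
      qed
      then show ?thesis
        using in_quotient_imp_non_empty[OF r B] by (simp add: connected_induce_iff D_def)
    qed
    then show ?thesis
      using partition_on_quotient[OF r] by (simp add: bond_lattice_def f_def A_def)
  qed
  have surj_f: "\<pi> \<in> f ` carrier L" if \<pi>: "\<pi> \<in> carrier (bond_lattice G)" for \<pi>
  proof -
    have part: "partition_on A \<pi>" and conn: "\<And>B. B \<in> \<pi> \<Longrightarrow> connected (G \<restriction> B)"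
      using \<pi> by (auto simp: bond_lattice_def A_def)
    \<comment> \<open>The preimage of \<open>\<pi>\<close> is cut out by the edges inside its
      blocks: such edges never leave a block, and connectedness joins all points of a block.\<close>
    define E where "E = {(u, v) \<in> D. \<exists>B\<in>\<pi>. u \<in> B \<and> v \<in> B}"
    define r where "r = {(u, v). \<exists>B\<in>\<pi>. u \<in> B \<and> v \<in> B}"
    have r: "equiv A r"
      unfolding r_def by (rule equiv_partition_on[OF part])
    have "E \<subseteq> D"
      by (auto simp: E_def)
    have "(E\<^sup>s)\<^sup>* \<inter> A \<times> A = r"
    proof (intro equalityI subrelI)
      fix u v assume "(u, v) \<in> (E\<^sup>s)\<^sup>* \<inter> A \<times> A"
      then have "(u, v) \<in> (E\<^sup>s)\<^sup>*" "u \<in> A"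
        by auto
      then show "(u, v) \<in> r"
      proof induction
        case base
        then show ?case
          using r by (auto simp: equiv_def refl_on_def)
      next
        case (step v w)
        have "(v, w) \<in> r"
          using step.hyps(2) by (auto simp: symcl_def E_def r_def)
        then show ?case
          using step r by (auto simp: equiv_def elim: transE)
      qed
    next
      fix u v assume uv: "(u, v) \<in> r"
      then obtain B where B: "B \<in> \<pi>" "u \<in> B" "v \<in> B"
        by (auto simp: r_def)
      have "(u, v) \<in> ((D \<inter> B \<times> B)\<^sup>s)\<^sup>*"
        using conn[OF B(1)] B by (simp add: connected_induce_iff D_def)
      moreover have "(D \<inter> B \<times> B)\<^sup>s \<subseteq> E\<^sup>s"
        using B(1) by (auto simp: symcl_def E_def)
      ultimately have "(u, v) \<in> (E\<^sup>s)\<^sup>*"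
        using rtrancl_mono by blast
      then show "(u, v) \<in> (E\<^sup>s)\<^sup>* \<inter> A \<times> A"
        using uv equiv_type[OF r] by blast
    qed
    then have "f (flat V p E) = \<pi>"
      unfolding f_def con[OF \<open>E \<subseteq> D\<close>]
      using partition_on_eq_quotient[OF part] by (simp add: r_def)
    then show ?thesis
      using \<open>E \<subseteq> D\<close> unfolding cL by blast
  qed
  have "inj_on f (carrier L)"
  proof (rule inj_onI)
    fix X Y assume XY: "X \<in> carrier L" "Y \<in> carrier L" and "f X = f Y"
    moreover have "refines A (f X) (f X)"
      using le_iff XY by blast
    \<comment> \<open>Equal images refine each other, so the two flats contain each other.\<close>
    ultimately show "X = Y"
      using le_iff[of X Y] le_iff[of Y X] by auto
  qed
  then have "bij_betw f (carrier L) (carrier (bond_lattice G))"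
    using f_bond surj_f by (auto simp: bij_betw_def)
  moreover have "order_emb L (bond_lattice G) f"
    unfolding order_emb_def
  proof (intro conjI ballI)
    show "weak_partial_order L"
      unfolding L_def by (rule partial_order.axioms(1)[OF partial_order_intersection_lattice])
    show "weak_partial_order (bond_lattice G)"
      by (rule partial_order.axioms(1)[OF partial_order_bond_lattice])
  qed (use le_iff in \<open>simp add: L_def bond_lattice_def intersection_lattice_def A_def\<close>)
  ultimately show ?thesis
    using partial_order_intersection_lattice partial_order_bond_lattice
    unfolding poset_iso_def L_def D_def by blast
qed

section \<open>The homogenized Linial arrangement as a graphic arrangement\<close>

text \<open>\<open>(k + 1) div 2\<close> recovers \<open>i\<close> from
  \<open>k = 2 * i - 1\<close>, and \<open>k div 2 + 1\<close> is the shifted index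
  \<open>j + 1\<close> for \<open>k = 2 * j\<close>.\<close>

definition linial_potential :: "(nat \<Rightarrow> real) \<times> (nat \<Rightarrow> real) \<Rightarrow> nat \<Rightarrow> real" where
  "linial_potential = (\<lambda>(x, y) k.
    if odd k then x ((k + 1) div 2) - y ((k + 1) div 2) else x (k div 2 + 1))"

lemma linial_potential_odd: "1 \<le> i \<Longrightarrow> linial_potential (x, y) (2 * i - 1) = x i - y i"
  by (simp add: linial_potential_def)

lemma linial_potential_even: "linial_potential (x, y) (2 * j) = x (j + 1)"
  by (simp add: linial_potential_def)

lemma linial_potential_surj:
  "\<exists>z\<in>linial_space n. \<forall>k\<in>{1..2 * n}. linial_potential z k = g k"
proof -
  \<comment> \<open>The even vertices prescribe \<open>x 2\<close>, ..., \<open>x (n + 1)\<close>,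
    and \<open>y\<close> is then solved from the odd ones. The value \<open>g 0\<close> given to
    \<open>x 1\<close> is arbitrary, since 0 is not a vertex.\<close>
  define x where "x = (\<lambda>i\<in>{1..n + 1}. g (2 * (i - 1)))"
  define y where "y = (\<lambda>i\<in>{1..n}. x i - g (2 * i - 1))"
  have "linial_potential (x, y) k = g k" if k: "k \<in> {1..2 * n}" for k
  proof (cases "odd k")
    case True
    then obtain i where "k = 2 * i - 1" "1 \<le> i" "i \<le> n"
      using k by (auto elim!: oddE intro!: that[of "(k + 1) div 2"])
    then show ?thesis
      using linial_potential_odd[of i x y] by (simp add: y_def)
  next
    case False
    then obtain j where "k = 2 * j" "j \<le> n"
      using k by (auto elim!: evenE)
    then show ?thesis
      using linial_potential_even[of x y j] by (simp add: x_def)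
  qed
  moreover have "(x, y) \<in> linial_space n"
    by (simp add: linial_space_def x_def y_def)
  ultimately show ?thesis
    by blast
qed

lemma linial_hyperplane_eq:
  assumes "1 \<le> i"
  shows "linial_hyperplane n i (j + 1) =
    {z \<in> linial_space n. linial_potential z (2 * i - 1) = linial_potential z (2 * j)}"
  using assms
  by (auto simp: linial_hyperplane_def linial_potential_odd linial_potential_even
      simp del: One_nat_def)

text \<open>The shift \<open>k = j + 1\<close> turns the index range
  \<open>i < k \<le> n + 1\<close> of the hyperplanes into the range
  \<open>i \<le> j \<le> n\<close> of the edges.\<close>

lemma homogenized_linial_graphic:
  "homogenized_linial n =
    {{z \<in> linial_space n. linial_potential z u = linial_potential z v} | u v.
      (u, v) \<in> parcs (Gamma_graph n)}"
proof (intro equalityI subsetI)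
  fix H assume "H \<in> homogenized_linial n"
  then obtain i k where ik: "1 \<le> i" "i < k" "k \<le> n + 1" "H = linial_hyperplane n i k"
    by (auto simp: homogenized_linial_def)
  moreover obtain j where j: "k = j + 1"
    using ik by (cases k) auto
  ultimately have "1 \<le> i \<and> i \<le> j \<and> j \<le> n \<and> {2 * i - 1, 2 * j} = {2 * i - 1, 2 * j}"
    by auto
  then have "(2 * i - 1, 2 * j) \<in> parcs (Gamma_graph n)"
    unfolding Gamma_graph_def pair_pre_digraph.select_convs mem_Collect_eq prod.case by blast
  then show "H \<in> {{z \<in> linial_space n. linial_potential z u = linial_potential z v} | u v.
      (u, v) \<in> parcs (Gamma_graph n)}"
    using linial_hyperplane_eq[OF ik(1), of n j] ik(4) j by blast
next
  fix H assume "H \<in> {{z \<in> linial_space n. linial_potential z u = linial_potential z v} | u v.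
      (u, v) \<in> parcs (Gamma_graph n)}"
  then obtain u v where H: "H = {z \<in> linial_space n. linial_potential z u = linial_potential z v}"
    and "(u, v) \<in> parcs (Gamma_graph n)"
    by blast
  then obtain i j where ij: "1 \<le> i" "i \<le> j" "j \<le> n" "{u, v} = {2 * i - 1, 2 * j}"
    by (auto simp: Gamma_graph_def)
  \<comment> \<open>The orientation of the arc is left open, but the equation is symmetric in
    \<open>u\<close> and \<open>v\<close>.\<close>
  then have "H = linial_hyperplane n i (j + 1)"
    unfolding linial_hyperplane_eq[OF ij(1)] H by (auto simp: doubleton_eq_iff)
  moreover have "i < j + 1" "j + 1 \<le> n + 1"
    using ij by auto
  ultimately show "H \<in> homogenized_linial n"
    using ij(1) unfolding homogenized_linial_def by blast
qed

theorem theorem3p2: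
  fixes n :: nat
  assumes "n \<ge> 1"
  shows "poset_iso (intersection_lattice (linial_space n) (homogenized_linial n))
                   (bond_lattice (with_proj (Gamma_graph n)))"
proof -
  interpret pair_graph "Gamma_graph n"
    by (rule pair_graph_Gamma_graph)
  have "wf_digraph (with_proj (Gamma_graph n))"
    by unfold_locales
  moreover have "\<exists>z\<in>linial_space n. \<forall>u\<in>verts (with_proj (Gamma_graph n)).
      linial_potential z u = g u" for g
    using linial_potential_surj[of n g] by (simp add: Gamma_graph_def)
  ultimately show ?thesis
    using poset_iso_graphic_arrangement[of "with_proj (Gamma_graph n)" "linial_space n"
        linial_potential]
    by (simp add: homogenized_linial_graphic)
qed

end
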